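(* Let $\alpha,x$ be real and $\gamma\in\mathbb{C}\setminus\{0,-1,-2,\dots\}$. Then for all complex $t$ with $|t|<\frac12$, the Laguerre polynomials satisfy $$\sum_{n=0}^{+\infty}\frac{\gamma}{n+\gamma}L_n^{(\alpha)}(x)\,t^n=(1-t)^{-\gamma}\,\Phi_1\left[\gamma,\gamma-\alpha;\gamma+1;\,\frac{t}{t-1},\,\frac{x\,t}{t-1}\right].$$
   Context: The Laguerre polynomials are defined by $L_{-1}^{(\alpha)}(x)=0$, $L_0^{(\alpha)}(x)=1$ and $(n+1)L_{n+1}^{(\alpha)}(x)=(2n+\alpha+1-x)L_n^{(\alpha)}(x)-(n+\alpha)L_{n-1}^{(\alpha)}(x)$ for $n\ge0$. Powers use the principal branch. Humbert's confluent hypergeometric function is $$\Phi_1[\alpha_1,\lambda;\alpha_2;X,Y]=\sum_{m,n\ge0}\frac{(\alpha_1)_{m+n}(\lambda)_m}{(\alpha_2)_{m+n}}\frac{X^m}{m!}\frac{Y^n}{n!},\qquad |X|<1,\ |Y|<\infty,$$ where $(b)_0=1$, $(b)_k=b(b+1)\cdots(b+k-1)$. *)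

theory Defs
  imports "HOL-Analysis.Analysis"
begin

text \<open>The second equation is the recurrence of the third with the convention
  \<open>L\<^sub>-\<^sub>1 = 0\<close>.\<close>

fun laguerre :: "nat \<Rightarrow> real \<Rightarrow> real \<Rightarrow> real" where
  "laguerre 0 \<alpha> x = 1"
| "laguerre (Suc 0) \<alpha> x = \<alpha> + 1 - x"
| "laguerre (Suc (Suc n)) \<alpha> x =
     ((2 * real (Suc n) + \<alpha> + 1 - x) * laguerre (Suc n) \<alpha> x
       - (real (Suc n) + \<alpha>) * laguerre n \<alpha> x) / (real (Suc n) + 1)"

text \<open>The double series is summed unconditionally over all pairs \<open>(m, n)\<close>; it is
  meaningful for \<open>norm X < 1\<close> and \<open>\<alpha>\<^sub>2\<close> not a nonpositive integer.\<close>

definition humbert_Phi1 :: "complex \<Rightarrow> complex \<Rightarrow> complex \<Rightarrow> complex \<Rightarrow> complex \<Rightarrow> complex" where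
  "humbert_Phi1 \<alpha>\<^sub>1 l \<alpha>\<^sub>2 X Y =
     (\<Sum>\<^sub>\<infinity>(m, n)\<in>UNIV. pochhammer \<alpha>\<^sub>1 (m + n) * pochhammer l m / pochhammer \<alpha>\<^sub>2 (m + n)
        * (X ^ m / fact m) * (Y ^ n / fact n))"

end

theory Submission
  imports Defs "HOL-Complex_Analysis.Complex_Analysis"
begin

text \<open>Grouping the double series along the diagonals \<open>m + n = k\<close>, where
  \<open>(\<gamma>)\<^sub>k / (\<gamma> + 1)\<^sub>k = \<gamma> / (\<gamma> + k)\<close>, shows that \<open>H(z) = \<Phi>\<^sub>1[\<gamma>, l; \<gamma> + 1; z, x z]\<close> solves
  \<open>z H' + \<gamma> H = \<gamma> (1 - z) powr (- l) * exp (x z)\<close>. With \<open>z = t / (t - 1)\<close> and \<open>l = \<gamma> - \<alpha>\<close>, the right-hand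
  side \<open>G(t)\<close> of the claim then satisfies \<open>t G' + \<gamma> G = \<gamma> W\<close>, where
  \<open>W(t) = (1 - t) powr (- \<alpha> - 1) * exp (x t / (t - 1))\<close> generates the Laguerre polynomials.
  Comparing Taylor coefficients gives \<open>(n + \<gamma>) G\<^sub>n = \<gamma> L\<^sub>n\<close>.\<close>

section \<open>Double series summed along diagonals\<close>

text \<open>Bounding \<open>g\<close> by a constant leaves a product of two absolutely summable
  series, so the whole family is absolutely summable over pairs. It may then be reindexed by
  \<open>(m, n) \<mapsto> (m + n, m)\<close> and summed over the finite fibres first.\<close>

lemma diagonal_sums:
  fixes a b g :: "nat \<Rightarrow> complex"
  assumes a: "summable (\<lambda>k. norm (a k))" and b: "summable (\<lambda>k. norm (b k))"
    and g: "Bseq g"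
  shows "(\<lambda>k. g k * (\<Sum>i\<le>k. a i * b (k - i))) sums
           (\<Sum>\<^sub>\<infinity>(m, n)\<in>UNIV. g (m + n) * (a m * b n))"
proof -
  let ?f = "\<lambda>(m, n). g (m + n) * (a m * b n)"
  let ?T = "SIGMA k:UNIV. {..k::nat}"
  let ?h = "\<lambda>(k, i). g k * (a i * b (k - i))"
  obtain C where C: "\<And>k. norm (g k) \<le> C"
    using g by (auto simp: Bseq_def)
  have "(\<lambda>(m, n). norm (a m) * norm (b n)) summable_on UNIV \<times> UNIV"
  proof (rule summable_on_SigmaI)
    fix m
    have "((\<lambda>n. norm (b n)) has_sum (\<Sum>n. norm (b n))) UNIV"
      by (rule sums_nonneg_imp_has_sum) (use b in \<open>auto intro: summable_sums\<close>)
    thus "((\<lambda>n. case (m, n) of (m, n) \<Rightarrow> norm (a m) * norm (b n)) has_sum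
        norm (a m) * (\<Sum>n. norm (b n))) UNIV"
      by (simp add: has_sum_cmult_right)
  qed (use a in \<open>auto intro!: summable_on_cmult_left simp: summable_on_UNIV_nonneg_real_iff\<close>)
  hence "(\<lambda>p. C * (case p of (m, n) \<Rightarrow> norm (a m) * norm (b n))) summable_on UNIV"
    by (intro summable_on_cmult_right) simp
  hence "(\<lambda>p. norm (?f p)) summable_on UNIV"
    by (rule summable_on_comparison_test)
       (auto simp: norm_mult intro!: mult_right_mono C)
  hence f: "(?f has_sum infsum ?f UNIV) UNIV"
    by (intro has_sum_infsum) (rule abs_summable_summable)
  have h: "(?h has_sum infsum ?f UNIV) ?T"
    by (rule iffD1[OF has_sum_reindex_bij_witness[where i = "\<lambda>(k, i). (i, k - i)"
          and j = "\<lambda>(m, n). (m + n, m)"] f]) auto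
  have "((\<lambda>k. g k * (\<Sum>i\<le>k. a i * b (k - i))) has_sum infsum ?f UNIV) UNIV"
    by (rule has_sum_SigmaD[OF h]) (auto simp: sum_distrib_left intro!: has_sum_finiteI)
  thus ?thesis
    by (rule has_sum_imp_sums)
qed

section \<open>Power series of \<open>(1 - z) powr (- l) * exp (x * z)\<close>\<close>

text \<open>This is the binomial series with exponent \<open>- l\<close> at \<open>- z\<close>; the
  signs of \<open>(- l) gchoose n\<close> and \<open>(- z) ^ n\<close> cancel.\<close>

lemma pochhammer_series_sums:
  fixes l z :: complex
  assumes "norm z < 1"
  shows "(\<lambda>n. pochhammer l n / fact n * z ^ n) sums (1 - z) powr (- l)"
proof -
  have "(\<lambda>n. ((- l) gchoose n) * (- z) ^ n) sums (1 + - z) powr (- l)"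
    by (rule gen_binomial_complex) (use assms in simp)
  moreover have "((- l) gchoose n) * (- z) ^ n = pochhammer l n / fact n * z ^ n" for n
    by (simp add: gbinomial_pochhammer power_minus[of z] flip: power_add mult_2)
  ultimately show ?thesis
    by simp
qed

text \<open>The series converges at a real point \<open>r\<close> with
  \<open>norm z < r < 1\<close>, hence absolutely at every point of smaller modulus.\<close>

lemma pochhammer_series_abs_summable:
  fixes l z :: complex
  assumes "norm z < 1"
  shows "summable (\<lambda>n. norm (pochhammer l n / fact n * z ^ n))"
proof -
  obtain r where r: "norm z < r" "r < 1"
    using dense[OF assms] by blast
  show ?thesis
  proof (rule powser_insidea)
    show "summable (\<lambda>n. pochhammer l n / fact n * complex_of_real r ^ n)"
      using pochhammer_series_sums[of "of_real r" l] r norm_ge_zero[of z]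
      by (auto simp: sums_iff)
    show "norm z < norm (complex_of_real r)"
      using r by simp
  qed
qed

text \<open>These are the Taylor coefficients of \<open>(1 - z) powr (- l) * exp (x * z)\<close>,
  written as a Cauchy product.\<close>

definition humbert_coeff :: "complex \<Rightarrow> complex \<Rightarrow> nat \<Rightarrow> complex" where
  "humbert_coeff l x k = (\<Sum>i\<le>k. pochhammer l i / fact i * (x ^ (k - i) / fact (k - i)))"

lemma humbert_coeff_power:
  "humbert_coeff l x k * z ^ k
     = (\<Sum>i\<le>k. (pochhammer l i / fact i * z ^ i) * ((x * z) ^ (k - i) / fact (k - i)))"
  unfolding humbert_coeff_def sum_distrib_right
proof (intro sum.cong refl)
  fix i assume "i \<in> {..k}"
  hence "z ^ k = z ^ i * z ^ (k - i)"
    by (simp flip: power_add)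
  thus "pochhammer l i / fact i * (x ^ (k - i) / fact (k - i)) * z ^ k
          = (pochhammer l i / fact i * z ^ i) * ((x * z) ^ (k - i) / fact (k - i))"
    by (simp add: power_mult_distrib)
qed

lemma exp_series_abs_summable:
  fixes y :: complex
  shows "summable (\<lambda>n. norm (y ^ n / fact n))"
  using summable_norm_exp[of y] by (simp add: scaleR_conv_of_real divide_inverse mult.commute)

lemma exp_series_suminf:
  fixes y :: complex
  shows "(\<Sum>n. y ^ n / fact n) = exp y"
  by (simp add: exp_def scaleR_conv_of_real divide_inverse mult.commute)

lemma humbert_coeff_sums:
  assumes "norm z < 1"
  shows "(\<lambda>k. humbert_coeff l x k * z ^ k) sums ((1 - z) powr (- l) * exp (x * z))"
  using Cauchy_product_sums[OF pochhammer_series_abs_summable[OF assms, of l]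
      exp_series_abs_summable[of "x * z"]] pochhammer_series_sums[OF assms, of l]
  by (simp add: humbert_coeff_power exp_series_suminf sums_iff)

section \<open>Humbert's function along \<open>(z, x * z)\<close> and its differential
  equation\<close>

lemma plus_of_nat_nonzero:
  fixes \<gamma> :: complex
  assumes "\<gamma> \<notin> \<int>\<^sub>\<le>\<^sub>0"
  shows "\<gamma> + of_nat k \<noteq> 0"
proof
  assume "\<gamma> + of_nat k = 0"
  hence "\<gamma> = - of_nat k"
    by (simp add: eq_neg_iff_add_eq_0)
  with assms show False
    by simp
qed

lemma pochhammer_ratio:
  fixes \<gamma> :: complex
  assumes "\<gamma> \<notin> \<int>\<^sub>\<le>\<^sub>0"
  shows "pochhammer \<gamma> k / pochhammer (\<gamma> + 1) k = \<gamma> / (\<gamma> + of_nat k)"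
proof -
  have nz: "\<gamma> + of_nat j \<noteq> 0" for j
    by (rule plus_of_nat_nonzero[OF assms])
  have "pochhammer (\<gamma> + 1) k \<noteq> 0"
    using nz by (auto simp: pochhammer_eq_0_iff eq_neg_iff_add_eq_0 add_ac)
       (metis add.assoc add.commute of_nat_Suc)
  \<comment> \<open>Both sides equal \<open>pochhammer \<gamma> (Suc k)\<close>, with the first or
    the last factor split off.\<close>
  moreover have "\<gamma> * pochhammer (\<gamma> + 1) k = (\<gamma> + of_nat k) * pochhammer \<gamma> k"
    by (simp only: pochhammer_rec[symmetric] pochhammer_rec'[symmetric])
  ultimately show ?thesis
    using nz[of k] by (simp add: divide_simps mult_ac)
qed

text \<open>The Pochhammer ratio depends on \<open>m + n\<close> alone and tends to 0, so it can
  serve as the bounded weight \<open>g\<close> of \<open>diagonal_sums\<close>; each diagonal then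
  contributes one term of the Cauchy product.\<close>

lemma humbert_Phi1_sums:
  fixes \<gamma> l x z :: complex
  assumes \<gamma>: "\<gamma> \<notin> \<int>\<^sub>\<le>\<^sub>0" and z: "norm z < 1"
  shows "(\<lambda>k. \<gamma> / (\<gamma> + of_nat k) * humbert_coeff l x k * z ^ k) sums
           humbert_Phi1 \<gamma> l (\<gamma> + 1) z (x * z)"
proof -
  have "(\<lambda>k. \<gamma> / (\<gamma> + of_nat k)) \<longlonglongrightarrow> 0"
    by (intro tendsto_divide_0[OF tendsto_const] tendsto_add_filterlim_at_infinity[OF tendsto_const]
          tendsto_of_nat)
  hence "Bseq (\<lambda>k. \<gamma> / (\<gamma> + of_nat k))"
    by (intro convergent_imp_Bseq convergentI)
  from diagonal_sums[OF pochhammer_series_abs_summable[OF z, of l]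
      exp_series_abs_summable[of "x * z"] this]
  have "(\<lambda>k. \<gamma> / (\<gamma> + of_nat k) * (humbert_coeff l x k * z ^ k)) sums
      (\<Sum>\<^sub>\<infinity>(m, n)\<in>UNIV. pochhammer \<gamma> (m + n) / pochhammer (\<gamma> + 1) (m + n) *
        ((pochhammer l m / fact m * z ^ m) * ((x * z) ^ n / fact n)))"
    by (simp only: humbert_coeff_power pochhammer_ratio[OF \<gamma>])
  thus ?thesis
    unfolding humbert_Phi1_def by (simp add: mult_ac)
qed

text \<open>The operator \<open>z d/dz + \<gamma>\<close> multiplies the k-th coefficient by
  \<open>\<gamma> + k\<close>. This cancels the denominator and leaves \<gamma> times the series of
  \<open>humbert_coeff_sums\<close>.\<close>

lemma humbert_Phi1_ODE:
  fixes \<gamma> l x z :: complex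
  assumes \<gamma>: "\<gamma> \<notin> \<int>\<^sub>\<le>\<^sub>0" and z: "norm z < 1"
  obtains D where "((\<lambda>z. humbert_Phi1 \<gamma> l (\<gamma> + 1) z (x * z)) has_field_derivative D) (at z)"
    and "z * D + \<gamma> * humbert_Phi1 \<gamma> l (\<gamma> + 1) z (x * z)
           = \<gamma> * ((1 - z) powr (- l) * exp (x * z))"
proof -
  define h where "h k = \<gamma> / (\<gamma> + of_nat k) * humbert_coeff l x k" for k
  let ?H = "\<lambda>z. humbert_Phi1 \<gamma> l (\<gamma> + 1) z (x * z)"
  define D where "D = (\<Sum>k. diffs h k * z ^ k)"
  have H: "(\<lambda>k. h k * w ^ k) sums ?H w" if "norm w < 1" for w
    unfolding h_def by (rule humbert_Phi1_sums[OF \<gamma> that])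
  hence sm: "summable (\<lambda>k. h k * w ^ k)" if "norm w < 1" for w
    using that by (auto simp: sums_iff)
  have "((\<lambda>w. \<Sum>k. h k * w ^ k) has_field_derivative D) (at z)"
    unfolding D_def by (rule termdiffs_strong'[OF sm z])
  hence 1: "(?H has_field_derivative D) (at z)"
    by (rule has_field_derivative_transform_within_open[where S = "ball 0 1"])
       (use z H in \<open>auto simp: sums_iff\<close>)
  have "summable (\<lambda>k. diffs h k * z ^ k)"
    by (rule termdiff_converges[OF z sm])
  hence "(\<lambda>k. z * (of_nat k * h k * z ^ (k - Suc 0))) sums (z * D)"
    unfolding D_def by (intro sums_mult diffs_equiv)
  \<comment> \<open>At \<open>k = 0\<close> the truncated exponent is harmless, since the factor
    \<open>of_nat k\<close> vanishes.\<close>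
  moreover have "z * (of_nat k * h k * z ^ (k - Suc 0)) = of_nat k * h k * z ^ k" for k
    by (cases k) auto
  ultimately have "(\<lambda>k. of_nat k * h k * z ^ k + \<gamma> * (h k * z ^ k)) sums (z * D + \<gamma> * ?H z)"
    by (intro sums_add sums_mult H z) simp
  moreover have "of_nat k * h k * z ^ k + \<gamma> * (h k * z ^ k) = \<gamma> * (humbert_coeff l x k * z ^ k)" for k
  proof -
    have "of_nat k * h k * z ^ k + \<gamma> * (h k * z ^ k) = (\<gamma> + of_nat k) * h k * z ^ k"
      by (simp add: algebra_simps)
    thus ?thesis
      using plus_of_nat_nonzero[OF \<gamma>, of k] by (simp add: h_def)
  qed
  ultimately have "(\<lambda>k. \<gamma> * (humbert_coeff l x k * z ^ k)) sums (z * D + \<gamma> * ?H z)"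
    by simp
  from sums_unique2[OF this sums_mult[OF humbert_coeff_sums[OF z]]] 1 that
  show thesis
    by blast
qed

section \<open>Generating function of the Laguerre polynomials\<close>

text \<open>The real part of \<open>1 - t\<close> is positive, which keeps \<open>1 - t\<close> off
  the branch cut of the principal power.\<close>

lemma one_minus_notin_nonpos_Reals:
  assumes "norm (t::complex) < 1"
  shows "1 - t \<notin> \<real>\<^sub>\<le>\<^sub>0" "t \<noteq> 1"
proof -
  have "Re t < 1"
    using assms complex_Re_le_cmod[of t] by linarith
  thus "1 - t \<notin> \<real>\<^sub>\<le>\<^sub>0"
    by (auto simp: complex_nonpos_Reals_iff)
  thus "t \<noteq> 1"
    by auto
qed

definition laguerre_gf :: "complex \<Rightarrow> complex \<Rightarrow> complex \<Rightarrow> complex" where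
  "laguerre_gf a x t = (1 - t) powr (- a - 1) * exp (x * (t / (t - 1)))"

lemma has_field_derivative_one_minus_powr:
  assumes "norm (t::complex) < 1"
  shows "((\<lambda>t. (1 - t) powr s) has_field_derivative - s * ((1 - t) powr s / (1 - t))) (at t)"
  using one_minus_notin_nonpos_Reals[OF assms]
  by (auto intro!: derivative_eq_intros simp: powr_diff)

lemma has_field_derivative_moebius:
  assumes "(t::complex) \<noteq> 1"
  shows "((\<lambda>t. t / (t - 1)) has_field_derivative - 1 / (1 - t)^2) (at t)"
  using assms by (auto intro!: derivative_eq_intros simp: divide_simps power2_eq_square algebra_simps)

text \<open>The second factor is the logarithmic derivative: the power contributes
  \<open>(a + 1) / (1 - t)\<close>, the exponential \<open>- x / (1 - t)^2\<close>.\<close>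

lemma has_field_derivative_laguerre_gf:
  assumes t: "norm t < 1"
  shows "(laguerre_gf a x has_field_derivative
           laguerre_gf a x t * ((a + 1) / (1 - t) - x / (1 - t)^2)) (at t)"
  unfolding laguerre_gf_def
  by (rule derivative_eq_intros has_field_derivative_one_minus_powr
        has_field_derivative_moebius refl t one_minus_notin_nonpos_Reals)+
     (use one_minus_notin_nonpos_Reals(2)[OF t] in \<open>simp add: algebra_simps\<close>)

text \<open>This turns a differential equation valid near 0 into an identity of formal power
  series.\<close>

lemma fps_expansion_unique_nhds:
  fixes F G :: "complex fps"
  assumes "f has_fps_expansion F" "g has_fps_expansion G" "\<forall>\<^sub>F t in nhds 0. g t = f t"
  shows "F = G"
  using fps_expansion_unique_complex[OF assms(1)]
    iffD1[OF has_fps_expansion_cong[OF assms(3) refl] assms(2)] .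

lemma laguerre_gf_has_fps_expansion:
  "laguerre_gf (of_real \<alpha>) (of_real x) has_fps_expansion
     Abs_fps (\<lambda>n. of_real (laguerre n \<alpha> x))"
proof -
  let ?a = "complex_of_real \<alpha>" and ?x = "complex_of_real x"
  let ?W = "laguerre_gf ?a ?x"
  define w where "w = fps_expansion ?W 0"
  have "?W holomorphic_on ball 0 1"
    by (rule holomorphic_onI)
       (auto simp: field_differentiable_def intro!: has_field_derivative_at_within
          has_field_derivative_laguerre_gf)
  hence w: "?W has_fps_expansion w"
    unfolding w_def by (intro has_fps_expansion_fps_expansion[of "ball 0 1"]) auto
  have w': "deriv ?W has_fps_expansion fps_deriv w"
    by (rule has_fps_expansion_deriv[OF w])
  \<comment> \<open>The equation \<open>(1 - t)\<^sup>2 W' = ((\<alpha> + 1) (1 - t) - x) W\<close>, expanded so that comparing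
    coefficients yields the three-term recurrence.\<close>
  have ode: "deriv ?W t - 2 * (t * deriv ?W t) + t * (t * deriv ?W t)
      = (?a + 1 - ?x) * ?W t - (?a + 1) * (t * ?W t)" if "t \<in> ball 0 1" for t
  proof -
    have t: "norm t < 1" "1 - t \<noteq> 0"
      using that one_minus_notin_nonpos_Reals(2)[of t] by auto
    have "u^2 * (w * (b / u - c / u^2)) = w * (b * u - c)" if "u \<noteq> 0" for u w b c :: complex
      using that by (simp add: right_diff_distrib power2_eq_square)
    from this[OF t(2)] have "(1 - t)^2 * deriv ?W t = ?W t * ((?a + 1) * (1 - t) - ?x)"
      unfolding DERIV_imp_deriv[OF has_field_derivative_laguerre_gf[OF t(1)]]
      by simp
    thus ?thesis
      by (simp add: power2_eq_square algebra_simps)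
  qed
  have L: "(\<lambda>t. deriv ?W t - 2 * (t * deriv ?W t) + t * (t * deriv ?W t)) has_fps_expansion
      fps_deriv w - fps_const 2 * (fps_X * fps_deriv w) + fps_X * (fps_X * fps_deriv w)"
    by (intro fps_expansion_intros w')
  have R: "(\<lambda>t. (?a + 1 - ?x) * ?W t - (?a + 1) * (t * ?W t)) has_fps_expansion
      fps_const (?a + 1 - ?x) * w - fps_const (?a + 1) * (fps_X * w)"
    by (intro fps_expansion_intros w)
  have "\<forall>\<^sub>F t in nhds 0. (?a + 1 - ?x) * ?W t - (?a + 1) * (t * ?W t)
      = deriv ?W t - 2 * (t * deriv ?W t) + t * (t * deriv ?W t)"
    using eventually_nhds_in_open[of "ball 0 1" "0::complex"]
    by (auto elim!: eventually_mono simp: ode)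
  from fps_expansion_unique_nhds[OF L R this]
  have eq: "fps_nth (fps_deriv w - fps_const 2 * (fps_X * fps_deriv w)
        + fps_X * (fps_X * fps_deriv w)) n
      = fps_nth (fps_const (?a + 1 - ?x) * w - fps_const (?a + 1) * (fps_X * w)) n" for n
    by simp
  have w0: "fps_nth w 0 = 1"
    using has_fps_expansion_imp_0_eq_fps_nth_0[OF w] by (simp add: laguerre_gf_def)
  \<comment> \<open>At index 0 every shifted term drops out, matching the convention that the
    polynomial of index -1 is 0.\<close>
  have w1: "fps_nth w (Suc 0) = ?a + 1 - ?x"
    using eq[of 0] by (simp add: w0)
  have rec: "(of_nat (Suc n) + 1) * fps_nth w (Suc (Suc n))
      = (2 * of_nat (Suc n) + ?a + 1 - ?x) * fps_nth w (Suc n)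
          - (of_nat (Suc n) + ?a) * fps_nth w n" for n
    using eq[of "Suc n"] by (cases n) (simp_all add: algebra_simps)
  have "fps_nth w n = of_real (laguerre n \<alpha> x) \<and>
      fps_nth w (Suc n) = of_real (laguerre (Suc n) \<alpha> x)" for n
  proof (induction n)
    case 0
    show ?case
      by (simp add: w0 w1)
  next
    case (Suc n)
    have nz: "of_nat (Suc n) + 1 \<noteq> (0 :: complex)"
      by (metis of_nat_Suc of_nat_neq_0 add.commute)
    have "of_real (laguerre (Suc (Suc n)) \<alpha> x) =
        ((2 * of_nat (Suc n) + ?a + 1 - ?x) * fps_nth w (Suc n)
          - (of_nat (Suc n) + ?a) * fps_nth w n) / (of_nat (Suc n) + 1)"
      using Suc by simp
    also have "\<dots> = fps_nth w (Suc (Suc n))"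
      unfolding rec[symmetric] using nz by simp
    finally show ?case
      using Suc by simp
  qed
  hence "w = Abs_fps (\<lambda>n. of_real (laguerre n \<alpha> x))"
    by (simp add: fps_eq_iff)
  thus ?thesis
    using w by simp
qed

section \<open>Differential equation of the right-hand side and comparison of coefficients\<close>

theorem corollary4p1:
  fixes \<alpha> x :: real and \<gamma> t :: complex
  assumes "\<gamma> \<notin> \<int>\<^sub>\<le>\<^sub>0" and "norm t < 1 / 2"
  shows "(\<lambda>n. \<gamma> / (of_nat n + \<gamma>) * of_real (laguerre n \<alpha> x) * t ^ n) sums
           ((1 - t) powr (- \<gamma>)
             * humbert_Phi1 \<gamma> (\<gamma> - of_real \<alpha>) (\<gamma> + 1) (t / (t - 1)) (of_real x * t / (t - 1)))"
proof -
  let ?a = "complex_of_real \<alpha>" and ?x = "complex_of_real x"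
  let ?H = "\<lambda>z. humbert_Phi1 \<gamma> (\<gamma> - ?a) (\<gamma> + 1) z (?x * z)"
  let ?W = "laguerre_gf ?a ?x"
  define G where "G t = (1 - t) powr (- \<gamma>) * ?H (t / (t - 1))" for t
  have ode: "\<exists>D. (G has_field_derivative D) (at t) \<and> t * D + \<gamma> * G t = \<gamma> * ?W t"
    if t: "norm t < 1 / 2" for t
  proof -
    define z where "z = t / (t - 1)"
    have t1: "norm t < 1" "1 - t \<notin> \<real>\<^sub>\<le>\<^sub>0" "t \<noteq> 1" "1 - t \<noteq> 0"
      using t one_minus_notin_nonpos_Reals[of t] by auto
    \<comment> \<open>The radius 1/2 enters here: \<open>norm (t - 1) > 1 / 2 > norm t\<close>
      places \<open>z\<close> in the unit disc, where the Humbert series converges.\<close>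
    have "norm (t - 1) > 1 / 2"
      using t norm_triangle_ineq2[of 1 t] by (simp add: norm_minus_commute)
    hence z: "norm z < 1"
      using t by (simp add: z_def norm_divide divide_simps)
    obtain D where D: "(?H has_field_derivative D) (at z)"
      and DE: "z * D + \<gamma> * ?H z = \<gamma> * ((1 - z) powr (- (\<gamma> - ?a)) * exp (?x * z))"
      using humbert_Phi1_ODE[OF assms(1) z] by blast
    let ?p = "(1 - t) powr (- \<gamma>)"
    have "((\<lambda>t. ?H (t / (t - 1))) has_field_derivative D * (- 1 / (1 - t)^2)) (at t)"
      by (rule DERIV_chain2[OF D[unfolded z_def] has_field_derivative_moebius[OF t1(3)]])
    hence G: "(G has_field_derivative
        ?p * (D * (- 1 / (1 - t)^2)) + (- (- \<gamma>) * (?p / (1 - t))) * ?H z) (at t)"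
      unfolding G_def z_def
      by (intro DERIV_mult' has_field_derivative_one_minus_powr t1)
    \<comment> \<open>Off the branch cut \<open>Ln (inverse u) = - Ln u\<close>, so the principal
      powers of \<open>1 - z\<close> become powers of \<open>1 - t\<close> with negated exponent.
      The total exponent below is
      \<open>- \<gamma> + (\<gamma> - \<alpha>) - 1 = - \<alpha> - 1\<close>.\<close>
    have "1 - z = inverse (1 - t)"
      using t1 by (simp add: z_def divide_simps)
    hence "(1 - z) powr (- (\<gamma> - ?a)) = (1 - t) powr (\<gamma> - ?a)"
      using t1 by (simp add: powr_def Ln_inverse) (simp add: left_diff_distrib)
    hence W: "?p * (1 - z) powr (- (\<gamma> - ?a)) / (1 - t) * exp (?x * z) = ?W t"
      using t1(4) by (simp add: laguerre_gf_def z_def powr_diff powr_minus field_simps)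
    have "z = - (t / (1 - t))"
      using minus_divide_right[of t "1 - t"] by (simp add: z_def)
    \<comment> \<open>By this chain rule identity, \<open>t d/dt\<close> becomes
      \<open>z d/dz\<close> divided by \<open>1 - t\<close>.\<close>
    hence zt: "t * (- 1 / (1 - t)^2) = z / (1 - t)"
      by (simp add: power2_eq_square)
    \<comment> \<open>Differentiating the prefactor gives \<gamma> \<open>G t\<close> times
      \<open>t / (1 - t)\<close>; adding \<gamma> \<open>G t\<close> produces the same factor
      \<open>1 / (1 - t)\<close> that the first term carries.\<close>
    have "t * (?p * (D * (- 1 / (1 - t)^2)) + (- (- \<gamma>) * (?p / (1 - t))) * ?H z) + \<gamma> * G t
        = ?p * D * (t * (- 1 / (1 - t)^2)) + ?p * \<gamma> * ?H z * (t / (1 - t) + 1)"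
      by (simp add: G_def z_def algebra_simps)
    also have "t / (1 - t) + 1 = 1 / (1 - t)"
      using t1(4) by (simp add: divide_simps)
    also have "?p * D * (t * (- 1 / (1 - t)^2)) + ?p * \<gamma> * ?H z * (1 / (1 - t))
        = ?p / (1 - t) * (z * D + \<gamma> * ?H z)"
      unfolding zt by (simp add: algebra_simps add_divide_distrib)
    also have "\<dots> = \<gamma> * ?W t"
      unfolding DE W[symmetric] by simp
    finally show ?thesis
      using G by blast
  qed
  define F where "F = fps_expansion G 0"
  have hol: "G holomorphic_on ball 0 (1 / 2)"
  proof (rule holomorphic_onI)
    fix t :: complex assume "t \<in> ball 0 (1 / 2)"
    then obtain D where "(G has_field_derivative D) (at t)"
      using ode[of t] by auto
    thus "G field_differentiable at t within ball 0 (1 / 2)"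
      unfolding field_differentiable_def by (blast intro: has_field_derivative_at_within)
  qed
  hence F: "G has_fps_expansion F"
    unfolding F_def by (intro has_fps_expansion_fps_expansion[of "ball 0 (1 / 2)"]) auto
  have L: "(\<lambda>t. t * deriv G t + \<gamma> * G t) has_fps_expansion fps_X * fps_deriv F + fps_const \<gamma> * F"
    by (intro fps_expansion_intros F)
  have ev: "\<forall>\<^sub>F t in nhds 0. \<gamma> * ?W t = t * deriv G t + \<gamma> * G t"
    using eventually_nhds_in_open[of "ball 0 (1 / 2)" "0::complex"]
  proof (rule eventually_mono)
    fix t :: complex assume "t \<in> ball 0 (1 / 2)"
    then obtain D where D: "(G has_field_derivative D) (at t)" "t * D + \<gamma> * G t = \<gamma> * ?W t"
      using ode[of t] by auto
    thus "\<gamma> * ?W t = t * deriv G t + \<gamma> * G t"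
      unfolding DERIV_imp_deriv[OF D(1)] by simp
  qed auto
  have R: "(\<lambda>t. \<gamma> * ?W t) has_fps_expansion
      fps_const \<gamma> * Abs_fps (\<lambda>n. of_real (laguerre n \<alpha> x))"
    by (intro fps_expansion_intros laguerre_gf_has_fps_expansion)
  from fps_expansion_unique_nhds[OF L R ev]
  have eq: "fps_nth (fps_X * fps_deriv F + fps_const \<gamma> * F) n
      = fps_nth (fps_const \<gamma> * Abs_fps (\<lambda>n. of_real (laguerre n \<alpha> x))) n" for n
    by simp
  have "fps_nth F n = \<gamma> / (of_nat n + \<gamma>) * of_real (laguerre n \<alpha> x)" for n
  proof -
    have "(of_nat n + \<gamma>) * fps_nth F n = \<gamma> * of_real (laguerre n \<alpha> x)"
      using eq[of n] by (cases n) (auto simp: algebra_simps)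
    thus ?thesis
      using plus_of_nat_nonzero[OF assms(1), of n]
      by (simp add: divide_simps add.commute mult.commute)
  qed
  \<comment> \<open>Holomorphy on the disc of radius 1/2 makes the Taylor series converge to
    \<open>G\<close> on all of that disc, although the coefficients were found from an identity near
    0.\<close>
  moreover have "(\<lambda>n. fps_nth F n * t ^ n) sums G t"
    by (rule has_fps_expansion_imp_sums_complex[OF F, of "ereal (1 / 2)"])
       (use hol assms(2) in auto)
  ultimately show ?thesis
    by (simp add: G_def)
qed

end
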